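(* Let $p$ be a prime and $r\ge 1$. Let $G_1(D),G_2(D)\in\mathbb{Z}_{p^r}[D]^{k\times n}$ be two equivalent polynomial generator matrices, both of which are reduced internal degree matrices. Then $\Delta_p(G_1)=\Delta_p(G_2)$.
   Context: $\mathbb{Z}_{p^r}=\mathbb{Z}/p^r\mathbb{Z}$; $\mathbb{Z}_{p^r}((D))$ is the ring of formal Laurent series; $\mathbb{Z}_{p^r}(D)$ is the ring of rational functions $a(D)/b(D)$ with $a,b\in\mathbb{Z}_{p^r}[D]$ and the lowest-degree coefficient of $b$ a unit (with $a/b\sim a_1/b_1$ iff $ab_1=a_1b$). A polynomial generator matrix (encoder) is a matrix in $\mathbb{Z}_{p^r}[D]^{k\times n}$ whose rows are linearly independent over $\mathbb{Z}_{p^r}(D)$. Two $k\times n$ polynomial generator matrices are equivalent if they generate the same code (the same $\mathbb{Z}_{p^r}((D))$-row span); equivalently, $G_1(D)=T(D)G_2(D)$ for some invertible $T(D)\in\mathbb{Z}_{p^r}(D)^{k\times k}$. A bar denotes reduction modulo $p$, to $\mathbb{Z}_p[D]$. For a polynomial generator matrix $G(D)$, $\Delta_p(G)\in\mathbb{Z}_p[D]$ is the (monic) greatest common divisor of the nonzero $k\times k$ minors of $\overline{G(D)}$. The internal degree of a $k\times n$ polynomial matrix is the maximum degree of its $k\times k$ minors. A $k\times n$ polynomial generator matrix $G(D)$ is a reduced internal degree matrix (RIDM) if, among all polynomial matrices of the form $M(D)G(D)$ with $M(D)$ a $k\times k$ non-singular (i.e. invertible) matrix over $\mathbb{Z}_{p^r}(D)$,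 it has the minimum possible internal degree. *)

theory Defs
  imports
    "HOL-Computational_Algebra.Computational_Algebra"
    "Jordan_Normal_Form.Matrix"
    "Jordan_Normal_Form.Determinant"
    "Jordan_Normal_Form.DL_Submatrix"
    "Berlekamp_Zassenhaus.Finite_Field"
begin

hide_const (open) up_ring.coeff

text \<open>
  The ring of integers modulo \<open>p ^ r\<close> is the type \<open>'q mod_ring\<close> with \<open>CARD('q) = p ^ r\<close>, and the
  prime field is \<open>'p mod_ring\<close> with \<open>CARD('p) = p\<close>.
\<close>


subsection \<open>The ring of rational functions\<close>

definition trailing_unit :: "'a::comm_ring_1 poly \<Rightarrow> bool" where
  "trailing_unit b \<longleftrightarrow> (\<exists>i. coeff b i dvd 1 \<and> (\<forall>j<i. coeff b j = 0))"

lemma trailing_unit_1: "trailing_unit 1"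
  unfolding trailing_unit_def by (rule exI[of _ 0]) simp

lemma coeff_mult_trailing:
  fixes a b :: "'a::comm_ring_1 poly"
  assumes "\<forall>j<m. coeff a j = 0" and "\<forall>j<n. coeff b j = 0"
  shows "coeff (a * b) (m + n) = coeff a m * coeff b n"
    and "\<forall>j<m + n. coeff (a * b) j = 0"
proof -
  have "coeff (a * b) (m + n) = (\<Sum>i\<le>m + n. coeff a i * coeff b (m + n - i))"
    by (simp add: coeff_mult)
  also have "\<dots> = (\<Sum>i\<in>{m}. coeff a i * coeff b (m + n - i))"
  proof (rule sum.mono_neutral_right)
    show "\<forall>i\<in>{..m + n} - {m}. coeff a i * coeff b (m + n - i) = 0"
    proof
      fix i assume i: "i \<in> {..m + n} - {m}"
      show "coeff a i * coeff b (m + n - i) = 0"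
      proof (cases "i < m")
        case False
        with i have "m + n - i < n" by auto
        then show ?thesis using assms by simp
      qed (use assms in simp)
    qed
  qed auto
  finally show "coeff (a * b) (m + n) = coeff a m * coeff b n" by simp
  show "\<forall>j<m + n. coeff (a * b) j = 0"
  proof (intro allI impI)
    fix j assume j: "j < m + n"
    have "coeff a i * coeff b (j - i) = 0" if "i \<le> j" for i
    proof (cases "i < m")
      case False
      with j that have "j - i < n" by auto
      then show ?thesis using assms by simp
    qed (use assms in simp)
    then show "coeff (a * b) j = 0" by (simp add: coeff_mult)
  qed
qed

lemma trailing_unit_mult:
  fixes a b :: "'a::comm_ring_1 poly"
  assumes "trailing_unit a" and "trailing_unit b"
  shows "trailing_unit (a * b)"
proof -
  obtain m n where
    m: "coeff a m dvd 1" "\<forall>j<m. coeff a j = 0" and n: "coeff b n dvd 1" "\<forall>j<n. coeff b j = 0"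
    using assms unfolding trailing_unit_def by blast
  from m(1) n(1) have "coeff a m * coeff b n dvd 1"
    using mult_dvd_mono by fastforce
  then show ?thesis
    unfolding trailing_unit_def
    using coeff_mult_trailing[OF m(2) n(2)] by (intro exI[of _ "m + n"]) simp
qed

lemma trailing_unit_cancel:
  fixes a b :: "'a::comm_ring_1 poly"
  assumes "trailing_unit b" and "a * b = 0"
  shows "a = 0"
proof (rule ccontr)
  assume "a \<noteq> 0"
  then have ex: "\<exists>m. coeff a m \<noteq> 0" by (auto simp: poly_eq_iff)
  define m where "m = (LEAST m. coeff a m \<noteq> 0)"
  have m: "coeff a m \<noteq> 0" "\<forall>j<m. coeff a j = 0"
    using LeastI_ex[OF ex] not_less_Least unfolding m_def by blast+
  obtain n where n: "coeff b n dvd 1" "\<forall>j<n. coeff b j = 0"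
    using assms(1) unfolding trailing_unit_def by blast
  obtain c where c: "coeff b n * c = 1" using n(1) by (metis dvdE)
  have "coeff a m * coeff b n = 0"
    using coeff_mult_trailing(1)[OF m(2) n(2)] assms(2) by simp
  then have "coeff a m * (coeff b n * c) = 0"
    by (metis mult.assoc mult_zero_left)
  with c m(1) show False by simp
qed

definition ratfun_rel ::
    "'a::comm_ring_1 poly \<times> 'a poly \<Rightarrow> 'a poly \<times> 'a poly \<Rightarrow> bool" where
  "ratfun_rel x y \<longleftrightarrow>
     trailing_unit (snd x) \<and> trailing_unit (snd y) \<and> fst x * snd y = fst y * snd x"

lemma part_equivp_ratfun_rel: "part_equivp (ratfun_rel :: 'a::comm_ring_1 poly \<times> 'a poly \<Rightarrow> _)"
proof (rule part_equivpI)
  show "\<exists>x::'a poly \<times> 'a poly. ratfun_rel x x"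
    by (rule exI[of _ "(0, 1)"]) (simp add: ratfun_rel_def trailing_unit_1)
  show "symp (ratfun_rel :: 'a poly \<times> 'a poly \<Rightarrow> _)"
    by (rule sympI) (simp add: ratfun_rel_def)
  show "transp (ratfun_rel :: 'a poly \<times> 'a poly \<Rightarrow> _)"
  proof (rule transpI)
    fix x y z :: "'a poly \<times> 'a poly"
    assume xy: "ratfun_rel x y" and yz: "ratfun_rel y z"
    have 1: "fst x * snd y = fst y * snd x" and 2: "fst y * snd z = fst z * snd y"
      using xy yz by (auto simp: ratfun_rel_def)
    have "(fst x * snd z - fst z * snd x) * snd y
        = (fst x * snd y) * snd z - (fst z * snd y) * snd x"
      by (simp add: algebra_simps)
    also have "\<dots> = 0" by (simp add: 1 2[symmetric] algebra_simps)
    finally have "fst x * snd z - fst z * snd x = 0"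
      using xy trailing_unit_cancel unfolding ratfun_rel_def by blast
    then show "ratfun_rel x z" using xy yz by (simp add: ratfun_rel_def)
  qed
qed

quotient_type (overloaded) 'a ratfun = "'a::comm_ring_1 poly \<times> 'a poly" / partial: ratfun_rel
  by (rule part_equivp_ratfun_rel)

instantiation ratfun :: (comm_ring_1) comm_ring_1
begin

lift_definition zero_ratfun :: "'a ratfun" is "(0, 1)"
  by (simp add: ratfun_rel_def trailing_unit_1)

lift_definition one_ratfun :: "'a ratfun" is "(1, 1)"
  by (simp add: ratfun_rel_def trailing_unit_1)

lift_definition plus_ratfun :: "'a ratfun \<Rightarrow> 'a ratfun \<Rightarrow> 'a ratfun"
  is "\<lambda>x y. (fst x * snd y + fst y * snd x, snd x * snd y)"
proof -
  fix x x' y y' :: "'a poly \<times> 'a poly"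
  assume "ratfun_rel x x'" and "ratfun_rel y y'"
  then have t: "trailing_unit (snd x)" "trailing_unit (snd x')"
      "trailing_unit (snd y)" "trailing_unit (snd y')"
    and x: "fst x * snd x' = fst x' * snd x" and y: "fst y * snd y' = fst y' * snd y"
    by (auto simp: ratfun_rel_def)
  have "(fst x * snd y + fst y * snd x) * (snd x' * snd y')
      = (fst x * snd x') * (snd y * snd y') + (fst y * snd y') * (snd x * snd x')"
    by (simp add: algebra_simps)
  also have "\<dots> = (fst x' * snd y' + fst y' * snd x') * (snd x * snd y)"
    unfolding x y by (simp add: algebra_simps)
  finally show "ratfun_rel (fst x * snd y + fst y * snd x, snd x * snd y)
      (fst x' * snd y' + fst y' * snd x', snd x' * snd y')"
    using t by (simp add: ratfun_rel_def trailing_unit_mult)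
qed

lift_definition uminus_ratfun :: "'a ratfun \<Rightarrow> 'a ratfun" is "\<lambda>x. (- fst x, snd x)"
  by (simp add: ratfun_rel_def)

definition minus_ratfun :: "'a ratfun \<Rightarrow> 'a ratfun \<Rightarrow> 'a ratfun" where
  "minus_ratfun x y = x + - y"

lift_definition times_ratfun :: "'a ratfun \<Rightarrow> 'a ratfun \<Rightarrow> 'a ratfun"
  is "\<lambda>x y. (fst x * fst y, snd x * snd y)"
proof -
  fix x x' y y' :: "'a poly \<times> 'a poly"
  assume "ratfun_rel x x'" and "ratfun_rel y y'"
  then have t: "trailing_unit (snd x)" "trailing_unit (snd x')"
      "trailing_unit (snd y)" "trailing_unit (snd y')"
    and x: "fst x * snd x' = fst x' * snd x" and y: "fst y * snd y' = fst y' * snd y"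
    by (auto simp: ratfun_rel_def)
  have "fst x * fst y * (snd x' * snd y') = (fst x * snd x') * (fst y * snd y')"
    by (simp add: algebra_simps)
  also have "\<dots> = fst x' * fst y' * (snd x * snd y)"
    unfolding x y by (simp add: algebra_simps)
  finally show "ratfun_rel (fst x * fst y, snd x * snd y) (fst x' * fst y', snd x' * snd y')"
    using t by (simp add: ratfun_rel_def trailing_unit_mult)
qed

instance
proof
  fix a b c :: "'a ratfun"
  show "a * b * c = a * (b * c)"
    by transfer (auto simp: ratfun_rel_def trailing_unit_mult algebra_simps)
  show "a * b = b * a"
    by transfer (auto simp: ratfun_rel_def trailing_unit_mult algebra_simps)
  show "1 * a = a"
    by transfer (auto simp: ratfun_rel_def)
  show "a + b + c = a + (b + c)"
    by transfer (auto simp: ratfun_rel_def trailing_unit_mult algebra_simps)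
  show "a + b = b + a"
    by transfer (auto simp: ratfun_rel_def trailing_unit_mult algebra_simps)
  show "0 + a = a"
    by transfer (auto simp: ratfun_rel_def)
  show "- a + a = 0"
    by transfer (auto simp: ratfun_rel_def trailing_unit_mult trailing_unit_1)
  show "a - b = a + - b"
    by (rule minus_ratfun_def)
  show "(a + b) * c = a * c + b * c"
    by transfer (auto simp: ratfun_rel_def trailing_unit_mult algebra_simps)
  show "(0::'a ratfun) \<noteq> 1"
    by transfer (simp add: ratfun_rel_def)
qed

end

definition ratfun_of_poly :: "'a::comm_ring_1 poly \<Rightarrow> 'a ratfun" where
  "ratfun_of_poly a = abs_ratfun (a, 1)"

abbreviation ratfun_mat :: "'a::comm_ring_1 poly mat \<Rightarrow> 'a ratfun mat" where
  "ratfun_mat \<equiv> map_mat ratfun_of_poly"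


subsection \<open>Encoders and codes\<close>

text \<open>
  Independence is stated for the rows as a family (not as a set), so a matrix with two equal rows
  is not an encoder.
\<close>

definition generator_matrix :: "nat \<Rightarrow> nat \<Rightarrow> 'a::comm_ring_1 poly mat \<Rightarrow> bool" where
  "generator_matrix k n G \<longleftrightarrow>
     G \<in> carrier_mat k n \<and>
     (\<forall>u \<in> carrier_vec k. (ratfun_mat G)\<^sup>T *\<^sub>v u = 0\<^sub>v n \<longrightarrow> u = 0\<^sub>v k)"

text \<open>Row vectors are encoded as vectors, so that \<open>u G\<close> reads \<open>G\<^sup>T *\<^sub>v u\<close>.\<close>

definition code :: "'a::comm_ring_1 poly mat \<Rightarrow> 'a fls vec set" where
  "code G = {(map_mat (\<lambda>a. fps_to_fls (fps_of_poly a)) G)\<^sup>T *\<^sub>v u | u. u \<in> carrier_vec (dim_row G)}"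

definition equivalent_encoders ::
    "nat \<Rightarrow> nat \<Rightarrow> 'a::comm_ring_1 poly mat \<Rightarrow> 'a poly mat \<Rightarrow> bool" where
  "equivalent_encoders k n G\<^sub>1 G\<^sub>2 \<longleftrightarrow>
     generator_matrix k n G\<^sub>1 \<and> generator_matrix k n G\<^sub>2 \<and> code G\<^sub>1 = code G\<^sub>2"


subsection \<open>Minors, internal degree and reduced internal degree matrices\<close>

definition full_minors :: "'a::comm_ring_1 mat \<Rightarrow> 'a set" where
  "full_minors A =
     {det (submatrix A UNIV J) | J. J \<subseteq> {..<dim_col A} \<and> card J = dim_row A}"

text \<open>
  Zero minors contribute \<open>degree 0 = 0\<close> instead of \<open>-\<infinity>\<close>; this does not affect the maximum as soon
  as some full minor is nonzero, which is the case for every matrix with independent rows.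
\<close>

definition internal_degree :: "'a::comm_ring_1 poly mat \<Rightarrow> nat" where
  "internal_degree G = Max (degree ` full_minors G)"

definition is_RIDM :: "nat \<Rightarrow> nat \<Rightarrow> 'a::comm_ring_1 poly mat \<Rightarrow> bool" where
  "is_RIDM k n G \<longleftrightarrow>
     generator_matrix k n G \<and>
     (\<forall>M \<in> carrier_mat k k. \<forall>G' \<in> carrier_mat k n.
        invertible_mat M \<and> ratfun_mat G' = M * ratfun_mat G \<longrightarrow>
        internal_degree G \<le> internal_degree G')"


subsection \<open>Reduction modulo \<open>p\<close>\<close>

definition mod_reduce :: "'q::nontriv mod_ring \<Rightarrow> 'p::prime_card mod_ring" where
  "mod_reduce x = of_int_mod_ring (to_int_mod_ring x)"

text \<open>\<open>Gcd\<close> on polynomials over a field is normalized, i.e. monic when nonzero.\<close>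

definition Delta :: "'p::prime_card itself \<Rightarrow> 'q::nontriv mod_ring poly mat \<Rightarrow> 'p mod_ring poly" where
  "Delta _ G =
     Gcd (full_minors (map_mat (map_poly (mod_reduce :: 'q mod_ring \<Rightarrow> 'p mod_ring)) G) - {0})"

end

theory Submission
  imports Defs
begin

text \<open>
  Two equivalent encoders satisfy \<open>b G\<^sub>1 = A G\<^sub>2\<close> with polynomial \<open>A\<close> and \<open>b\<close>, where \<open>b\<close> is a
  full minor of \<open>G\<^sub>2\<close> that does not vanish modulo \<open>p\<close>. A polynomial that does not vanish modulo \<open>p\<close>
  becomes, after multiplication by a unit of the polynomial ring, a polynomial with unit leading
  coefficient whose degree is that of its reduction. Since such units can be absorbed into a row of
  the encoder, passing from a reduced internal degree matrix \<open>G\<close> to \<open>M G\<close> can never multiply the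
  reduced minors by a rational function of negative degree. If some entry of \<open>A\<close> were not divisible
  by \<open>b\<close> modulo \<open>p\<close>, exchanging one row of \<open>G\<^sub>2\<close> would achieve exactly that. Hence modulo \<open>p\<close> each of
  \<open>G\<^sub>1\<close> and \<open>G\<^sub>2\<close> is a polynomial multiple of the other, and the gcds of their minors divide each
  other.
\<close>

hide_const (open) module.smult

section \<open>Units and polynomials with unit leading coefficient\<close>

text \<open>The geometric sum of the powers of \<open>x\<close> below \<open>m\<close> is the
  inverse, because \<open>1 - x ^ m\<close> factors through \<open>1 - x\<close>.\<close>

lemma power_nilpotent_imp_unit:
  fixes x :: "'a::comm_ring_1"
  assumes "x ^ m = 0"
  shows "1 - x dvd 1"
  using assms one_diff_power_eq[of x m] by (metis diff_zero dvd_triv_left)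

text \<open>Pseudo-division works over any commutative ring but scales \<open>h\<close> by a power
  of \<open>lead_coeff g\<close>; the same power of the inverse \<open>c\<close> undoes the
  scaling.\<close>

lemma unit_lead_coeff_division:
  fixes g h :: "'a::comm_ring_1 poly"
  assumes g: "lead_coeff g dvd 1"
  obtains q s where "h = g * q + s" and "s = 0 \<or> degree s < degree g"
proof -
  have g0: "g \<noteq> 0" using g by auto
  obtain q s where qs: "pseudo_divmod h g = (q, s)" by force
  define e where "e = Suc (degree h) - degree g"
  from g obtain c where c: "lead_coeff g * c = 1" by (metis dvdE)
  have "smult (lead_coeff g ^ e) h = g * q + s"
    using pseudo_divmod(1)[OF g0 qs] by (simp add: e_def)
  then have "smult (c ^ e) (smult (lead_coeff g ^ e) h) = g * smult (c ^ e) q + smult (c ^ e) s"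
    by (simp add: smult_add_right)
  moreover have "c ^ e * lead_coeff g ^ e = 1"
    using c by (metis mult.commute power_mult_distrib power_one)
  ultimately have "h = g * smult (c ^ e) q + smult (c ^ e) s"
    by simp
  moreover have "smult (c ^ e) s = 0 \<or> degree (smult (c ^ e) s) < degree g"
    using pseudo_divmod(2)[OF g0 qs] degree_smult_le[of "c ^ e" s] by auto
  ultimately show thesis by (rule that)
qed

text \<open>Zero divisors cannot make the top coefficient of the product vanish, because one of its
  two factors is a unit.\<close>

lemma unit_lead_coeff_mult:
  fixes g h :: "'a::comm_ring_1 poly"
  assumes g: "lead_coeff g dvd 1" and h: "h \<noteq> 0"
  shows "degree (g * h) = degree g + degree h" and "g * h \<noteq> 0"
proof -
  from g obtain c where c: "lead_coeff g * c = 1" by (metis dvdE)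
  have "c * (lead_coeff g * lead_coeff h) = lead_coeff h"
    by (metis c mult.assoc mult.commute mult_1)
  then have "coeff (g * h) (degree g + degree h) \<noteq> 0"
    using h by (metis coeff_mult_degree_sum leading_coeff_0_iff mult_zero_right)
  then show "degree (g * h) = degree g + degree h" "g * h \<noteq> 0"
    using degree_mult_le[of g h] le_degree by (force, force)
qed

section \<open>Embeddings of polynomials into rational functions and Laurent series\<close>

lemma ratfun_of_poly_eq_iff: "ratfun_of_poly a = ratfun_of_poly b \<longleftrightarrow> a = b"
proof -
  have "ratfun_rel (x, 1) (x, 1)" for x :: "'a poly"
    by (simp add: ratfun_rel_def trailing_unit_1)
  then have "ratfun_rel (a, 1) (b, 1) \<longleftrightarrow> ratfun_of_poly a = ratfun_of_poly b"
    unfolding ratfun_of_poly_def using Quotient3_rel[OF Quotient3_ratfun] by metis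
  then show ?thesis by (simp add: ratfun_rel_def trailing_unit_1)
qed

interpretation ratfun_of_poly: inj_comm_ring_hom "ratfun_of_poly :: 'a::comm_ring_1 poly \<Rightarrow> _"
proof
  have r: "ratfun_rel (x, 1) (x, 1)" for x :: "'a poly"
    by (simp add: ratfun_rel_def trailing_unit_1)
  fix x y :: "'a poly"
  show "ratfun_of_poly (0 :: 'a poly) = 0" "ratfun_of_poly (1 :: 'a poly) = 1"
    by (simp_all add: ratfun_of_poly_def zero_ratfun_def one_ratfun_def)
  show "ratfun_of_poly (x + y) = ratfun_of_poly x + ratfun_of_poly y"
    unfolding ratfun_of_poly_def by (simp add: plus_ratfun.abs_eq[OF r r])
  show "ratfun_of_poly (x * y) = ratfun_of_poly x * ratfun_of_poly y"
    unfolding ratfun_of_poly_def by (simp add: times_ratfun.abs_eq[OF r r])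
next
  fix x :: "'a poly"
  assume "ratfun_of_poly x = 0"
  moreover have "ratfun_of_poly (0 :: 'a poly) = 0"
    by (simp add: ratfun_of_poly_def zero_ratfun_def)
  ultimately show "x = 0" using ratfun_of_poly_eq_iff[of x 0] by simp
qed

lemma trailing_unit_imp_ratfun_unit:
  assumes "trailing_unit t"
  shows "ratfun_of_poly t dvd 1"
proof -
  have "ratfun_rel (t, 1) (t, 1)" "ratfun_rel (1, t) (1, t)" "ratfun_rel (t, t) (1, 1)"
    using assms by (simp_all add: ratfun_rel_def trailing_unit_1)
  then have "ratfun_of_poly t * abs_ratfun (1, t) = 1"
    unfolding ratfun_of_poly_def one_ratfun_def
    using Quotient3_rel[OF Quotient3_ratfun, of "(t, t)" "(1, 1)"]
    by (simp add: times_ratfun.abs_eq trailing_unit_1 ratfun_rel_def)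
  then show ?thesis by (metis dvd_triv_left)
qed

text \<open>Codes are spans over Laurent series; injectivity brings identities found there back to
  polynomials.\<close>

interpretation poly_to_fls: inj_comm_ring_hom
  "\<lambda>a :: 'a::comm_ring_1 poly. fps_to_fls (fps_of_poly a)"
  by unfold_locales
    (auto simp: fps_of_poly_add fps_of_poly_mult fls_times_fps_to_fls fps_of_poly_eq_iff
      simp flip: fps_of_poly_0)


subsection \<open>Full minors and codes\<close>

text \<open>The inverse is the adjugate scaled by the inverse \<open>c\<close> of the
  determinant.\<close>

lemma dvd_one_imp_invertible_mat:
  fixes A :: "'a::comm_ring_1 mat"
  assumes A: "A \<in> carrier_mat k k" and d: "det A dvd 1"
  shows "invertible_mat A"
proof -
  from d obtain c where c: "det A * c = 1" by (metis dvdE)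
  note adj = adj_mat[OF A]
  have "A * (c \<cdot>\<^sub>m adj_mat A) = c \<cdot>\<^sub>m (A * adj_mat A)"
    by (rule mult_smult_distrib[OF A adj(1)])
  also have "\<dots> = 1\<^sub>m k"
    unfolding adj(2) using c by (intro eq_matI) (auto simp: mult.commute)
  finally have 1: "A * (c \<cdot>\<^sub>m adj_mat A) = 1\<^sub>m k" .
  have "(c \<cdot>\<^sub>m adj_mat A) * A = c \<cdot>\<^sub>m (adj_mat A * A)"
    by (rule mult_smult_assoc_mat[OF adj(1) A])
  also have "\<dots> = 1\<^sub>m k"
    unfolding adj(3) using c by (intro eq_matI) (auto simp: mult.commute)
  finally have 2: "(c \<cdot>\<^sub>m adj_mat A) * A = 1\<^sub>m k" .
  show ?thesis
    unfolding invertible_mat_def inverts_mat_def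
    using A adj(1) 1 2 by (auto intro!: exI[of _ "c \<cdot>\<^sub>m adj_mat A"])
qed

lemma full_submatrix:
  assumes "A \<in> carrier_mat k n" and "J \<subseteq> {..<n}" and "card J = k"
  shows "submatrix A UNIV J \<in> carrier_mat k k"
    and "\<And>i j. i < k \<Longrightarrow> j < k \<Longrightarrow> submatrix A UNIV J $$ (i, j) = A $$ (i, pick J j)"
    and "\<And>j. j < k \<Longrightarrow> pick J j < n"
proof -
  have J: "{j. j < n \<and> j \<in> J} = J" using assms(2) by auto
  show "submatrix A UNIV J \<in> carrier_mat k k"
    using assms J by (auto simp: submatrix_def)
  show "submatrix A UNIV J $$ (i, j) = A $$ (i, pick J j)" if "i < k" "j < k" for i j
    using that assms J by (subst submatrix_index) (auto simp: pick_UNIV)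
  show "pick J j < n" if "j < k" for j
    using pick_in_set_le[of j J] that assms by auto
qed

lemma submatrix_mult_right:
  assumes A: "A \<in> carrier_mat k k" and G: "G \<in> carrier_mat k n"
    and J: "J \<subseteq> {..<n}" "card J = k"
  shows "submatrix (A * G) UNIV J = A * submatrix G UNIV J"
proof -
  have AG: "A * G \<in> carrier_mat k n" using A G by simp
  note 1 = full_submatrix[OF AG J] and 2 = full_submatrix[OF G J]
  show ?thesis
  proof (rule eq_matI)
    fix i j assume "i < dim_row (A * submatrix G UNIV J)" "j < dim_col (A * submatrix G UNIV J)"
    then have ij: "i < k" "j < k" using A 2(1) by auto
    have "col G (pick J j) = col (submatrix G UNIV J) j"
      using ij G 2 by (intro eq_vecI) auto
    then show "submatrix (A * G) UNIV J $$ (i, j) = (A * submatrix G UNIV J) $$ (i, j)"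
      using ij A G 1(1) 2(1) 1(2)[of i j] 1(3)[of j] 2(2)[of i j] by simp
  qed (use A 1(1) 2(1) in auto)
qed

text \<open>Choosing columns commutes with multiplication from the left, so all full minors change
  by one common factor. Both the degree comparison and the gcd comparison rest on this.\<close>

lemma full_minor_mult:
  assumes "A \<in> carrier_mat k k" "G \<in> carrier_mat k n" "J \<subseteq> {..<n}" "card J = k"
  shows "det (submatrix (A * G) UNIV J) = det A * det (submatrix G UNIV J)"
  using submatrix_mult_right[OF assms] det_mult[OF assms(1)] full_submatrix(1)[OF assms(2-4)] by simp

lemma full_minor_smult:
  assumes "G \<in> carrier_mat k n" "J \<subseteq> {..<n}" "card J = k"
  shows "det (submatrix (b \<cdot>\<^sub>m G) UNIV J) = b ^ k * det (submatrix G UNIV J)"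
proof -
  have bG: "b \<cdot>\<^sub>m G \<in> carrier_mat k n" using assms(1) by simp
  note 1 = full_submatrix[OF assms] and 2 = full_submatrix[OF bG assms(2,3)]
  have "submatrix (b \<cdot>\<^sub>m G) UNIV J = b \<cdot>\<^sub>m submatrix G UNIV J"
    using 1 2 assms(1) by (intro eq_matI) auto
  then show ?thesis using 1(1) by simp
qed

lemma (in comm_ring_hom) full_minor_hom:
  assumes "G \<in> carrier_mat k n" "J \<subseteq> {..<n}" "card J = k"
  shows "det (submatrix (map_mat hom G) UNIV J) = hom (det (submatrix G UNIV J))"
proof -
  have hG: "map_mat hom G \<in> carrier_mat k n" using assms(1) by simp
  note 1 = full_submatrix[OF assms] and 2 = full_submatrix[OF hG assms(2,3)]
  have "submatrix (map_mat hom G) UNIV J = map_mat hom (submatrix G UNIV J)"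
    using 1 2 assms(1) by (intro eq_matI) auto
  then show ?thesis by simp
qed

section \<open>Nonzero full minors from independent rows\<close>

text \<open>Induction on the number of rows, in the manner of McCoy's theorem: border a nonzero
  minor of the first \<open>k\<close> rows by row \<open>k\<close> and an arbitrary column
  \<open>j\<close>. If all bordered determinants vanished, their common cofactors would form a
  relation between the rows, and its last coefficient is the old nonzero minor. Columns are chosen
  by a function, without any order, so that bordering is just \<open>g(k := j)\<close>.\<close>

lemma independent_rows_imp_minor_nonzero:
  fixes G :: "nat \<Rightarrow> nat \<Rightarrow> 'a::comm_ring_1"
  assumes "\<And>u. (\<And>j. j < n \<Longrightarrow> (\<Sum>i<k. G i j * u i) = 0) \<Longrightarrow> \<forall>i<k. u i = 0"
  shows "\<exists>g. (\<forall>j<k. g j < n) \<and> det (mat k k (\<lambda>(i, j). G i (g j))) \<noteq> 0"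
  using assms
proof (induction k)
  case 0
  have "det (mat 0 0 (\<lambda>(i, j). G i (g j))) = 1" for g
    by (rule det_dim_zero) simp
  then show ?case by simp
next
  case (Suc k)
  have "\<exists>g. (\<forall>j<k. g j < n) \<and> det (mat k k (\<lambda>(i, j). G i (g j))) \<noteq> 0"
  proof (rule Suc.IH)
    fix u assume u: "\<And>j. j < n \<Longrightarrow> (\<Sum>i<k. G i j * u i) = 0"
    have "(\<Sum>i<Suc k. G i j * (if i = k then 0 else u i)) = 0" if "j < n" for j
      using u[OF that] by simp
    then have "\<forall>i<Suc k. (if i = k then 0 else u i) = 0" by (rule Suc.prems)
    then show "\<forall>i<k. u i = 0" by (metis less_SucI less_irrefl)
  qed
  then obtain g where g: "\<forall>j<k. g j < n" and g0: "det (mat k k (\<lambda>(i, j). G i (g j))) \<noteq> 0"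
    by blast
  \<comment> \<open>The last column of \<open>B j\<close> does not enter the cofactors along that
    column, so they are the same for all \<open>j\<close> and can be taken from
    \<open>B 0\<close>.\<close>
  define B where "B j = mat (Suc k) (Suc k) (\<lambda>(i, c). G i ((g(k := j)) c))" for j
  define u where "u i = cofactor (B 0) i k" for i
  have B: "B j \<in> carrier_mat (Suc k) (Suc k)" for j by (simp add: B_def)
  have del: "mat_delete (B j) i k = mat_delete (B 0) i k" for i j
    by (rule eq_matI) (auto simp: mat_delete_def B_def)
  have det_B: "det (B j) = (\<Sum>i<Suc k. G i j * u i)" for j
  proof -
    have "det (B j) = (\<Sum>i<Suc k. B j $$ (i, k) * cofactor (B j) i k)"
      by (rule laplace_expansion_column[OF B]) simp
    also have "\<dots> = (\<Sum>i<Suc k. G i j * u i)"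
    proof (rule sum.cong)
      fix i assume "i \<in> {..<Suc k}"
      then have "B j $$ (i, k) = G i j" by (simp add: B_def)
      moreover have "cofactor (B j) i k = u i" by (simp only: u_def cofactor_def del[of j i])
      ultimately show "B j $$ (i, k) * cofactor (B j) i k = G i j * u i" by simp
    qed simp
    finally show ?thesis .
  qed
  have u_k: "u k = det (mat k k (\<lambda>(i, j). G i (g j)))"
  proof -
    have "mat_delete (B 0) k k = mat k k (\<lambda>(i, j). G i (g j))"
      by (rule eq_matI) (auto simp: mat_delete_def B_def)
    then show ?thesis by (simp add: u_def cofactor_def)
  qed
  have "\<exists>j<n. det (B j) \<noteq> 0"
  proof (rule ccontr)
    assume "\<not> (\<exists>j<n. det (B j) \<noteq> 0)"
    then have "(\<Sum>i<Suc k. G i j * u i) = 0" if "j < n" for j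
      using that det_B[of j] by metis
    then have "\<forall>i<Suc k. u i = 0" by (rule Suc.prems)
    with u_k g0 show False by simp
  qed
  then obtain j where j: "j < n" "det (B j) \<noteq> 0" by blast
  show ?case
  proof (intro exI conjI)
    show "\<forall>c<Suc k. (g(k := j)) c < n" using g j(1) by (simp add: less_Suc_eq)
    show "det (mat (Suc k) (Suc k) (\<lambda>(i, c). G i ((g(k := j)) c))) \<noteq> 0"
      using j(2) by (simp only: B_def not_False_eq_True)
  qed
qed

text \<open>The column choice \<open>g\<close> is injective, since a repeated column would make the
  determinant zero; it remains to pass from the sequence \<open>g\<close> to its set of values in
  increasing order.\<close>

lemma independent_rows_imp_full_minor_nonzero:
  fixes G :: "'a::comm_ring_1 mat"
  assumes G: "G \<in> carrier_mat k n"
    and indep: "\<And>u. u \<in> carrier_vec k \<Longrightarrow> G\<^sup>T *\<^sub>v u = 0\<^sub>v n \<Longrightarrow> u = 0\<^sub>v k"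
  shows "\<exists>J. J \<subseteq> {..<n} \<and> card J = k \<and> det (submatrix G UNIV J) \<noteq> 0"
proof -
  have "\<exists>g. (\<forall>j<k. g j < n) \<and> det (mat k k (\<lambda>(i, j). G $$ (i, g j))) \<noteq> 0"
  proof (rule independent_rows_imp_minor_nonzero)
    fix u assume u: "\<And>j. j < n \<Longrightarrow> (\<Sum>i<k. G $$ (i, j) * u i) = 0"
    have "G\<^sup>T *\<^sub>v vec k u = 0\<^sub>v n"
      using G u by (intro eq_vecI) (auto simp: scalar_prod_def lessThan_atLeast0)
    then have "vec k u = 0\<^sub>v k" by (intro indep) auto
    then show "\<forall>i<k. u i = 0" by (metis index_vec index_zero_vec(1))
  qed
  then obtain g where g: "\<forall>j<k. g j < n" and g0: "det (mat k k (\<lambda>(i, j). G $$ (i, g j))) \<noteq> 0"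
    by blast
  let ?B = "mat k k (\<lambda>(i, j). G $$ (i, g j))"
  have "inj_on g {..<k}"
  proof (rule inj_onI, rule ccontr)
    fix a b assume "a \<in> {..<k}" "b \<in> {..<k}" "g a = g b" "a \<noteq> b"
    then have "det ?B = 0"
      by (intro det_identical_columns[of ?B k a b]) (auto intro!: eq_vecI)
    with g0 show False by simp
  qed
  define J where "J = g ` {..<k}"
  have J: "J \<subseteq> {..<n}" "card J = k"
    using g \<open>inj_on g {..<k}\<close> by (auto simp: J_def card_image)
  note S = full_submatrix[OF G J]
  \<comment> \<open>The position of column \<open>g c\<close> in the increasing enumeration of
    \<open>J\<close>.\<close>
  define \<sigma> where "\<sigma> c = card {a \<in> J. a < g c}" for c
  have \<sigma>: "\<sigma> c < k" "pick J (\<sigma> c) = g c" if "c < k" for c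
  proof -
    have "g c \<in> J" using that by (auto simp: J_def)
    then show "pick J (\<sigma> c) = g c" unfolding \<sigma>_def by (rule pick_card_in_set)
    have "{a \<in> J. a < g c} \<subset> J" using \<open>g c \<in> J\<close> by auto
    moreover have "finite J" by (simp add: J_def)
    ultimately show "\<sigma> c < k" unfolding \<sigma>_def using psubset_card_mono J by metis
  qed
  \<comment> \<open>Multiplication by \<open>P\<close> reorders the columns. Multiplicativity of the
    determinant then transfers nonvanishing, without computing the sign
    \<open>det P\<close>.\<close>
  define P :: "'a mat" where "P = mat k k (\<lambda>(a, c). if a = \<sigma> c then 1 else 0)"
  have P: "P \<in> carrier_mat k k" by (simp add: P_def)
  have "?B = submatrix G UNIV J * P"
  proof (rule eq_matI)
    fix i c assume "i < dim_row (submatrix G UNIV J * P)" "c < dim_col (submatrix G UNIV J * P)"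
    then have ic: "i < k" "c < k" using S(1) P by auto
    have "(submatrix G UNIV J * P) $$ (i, c)
        = (\<Sum>a<k. submatrix G UNIV J $$ (i, a) * (if a = \<sigma> c then 1 else 0))"
      using ic S(1) P by (simp add: scalar_prod_def P_def lessThan_atLeast0)
    also have "\<dots> = (\<Sum>a<k. if a = \<sigma> c then submatrix G UNIV J $$ (i, a) else 0)"
      by (rule sum.cong) auto
    also have "\<dots> = G $$ (i, g c)"
      using ic \<sigma>[OF ic(2)] S(2) by simp
    finally show "?B $$ (i, c) = (submatrix G UNIV J * P) $$ (i, c)" using ic by simp
  qed (use S(1) P in auto)
  then have "det ?B = det (submatrix G UNIV J) * det P"
    using det_mult[OF S(1) P] by simp
  with g0 J show ?thesis by auto
qed

section \<open>Sets of full minors and their degrees\<close>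

lemma full_minors_carrier:
  "G \<in> carrier_mat k n \<Longrightarrow>
     full_minors G = {det (submatrix G UNIV J) | J. J \<subseteq> {..<n} \<and> card J = k}"
  by (auto simp: full_minors_def)

lemma finite_full_minors: "finite (full_minors A)"
proof -
  have "full_minors A \<subseteq> (\<lambda>J. det (submatrix A UNIV J)) ` Pow {..<dim_col A}"
    by (auto simp: full_minors_def)
  then show ?thesis by (rule finite_subset) simp
qed

lemma poly_lift_exists:
  assumes "surj f" and f0: "f 0 = 0"
  shows "\<exists>q. map_poly f q = (p :: 'b::zero poly)"
proof (induction p)
  case 0
  show ?case by (rule exI[of _ 0]) simp
next
  case (pCons a p)
  then obtain q where q: "map_poly f q = p" by blast
  obtain b where b: "f b = a" using assms(1) by (metis surjD)
  have "map_poly f (pCons b q) = pCons a p"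
    by (rule poly_eqI) (use b q f0 in \<open>auto simp: coeff_map_poly coeff_pCons split: nat.splits\<close>)
  then show ?case by blast
qed

lemma internal_degree_ge:
  assumes "G \<in> carrier_mat k n" "J \<subseteq> {..<n}" "card J = k"
  shows "degree (det (submatrix G UNIV J)) \<le> internal_degree G"
  unfolding internal_degree_def
  by (rule Max_ge) (use assms finite_full_minors in \<open>auto simp: full_minors_carrier\<close>)

text \<open>The witness \<open>J\<^sub>0\<close> ensures that the maximum is taken over a nonempty
  set.\<close>

lemma internal_degree_less:
  assumes G: "G \<in> carrier_mat k n" and "J\<^sub>0 \<subseteq> {..<n}" "card J\<^sub>0 = k"
    and less: "\<And>J. J \<subseteq> {..<n} \<Longrightarrow> card J = k \<Longrightarrow> degree (det (submatrix G UNIV J)) < d"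
  shows "internal_degree G < d"
proof -
  have "full_minors G \<noteq> {}" using assms by (auto simp: full_minors_carrier)
  then have "internal_degree G \<in> degree ` full_minors G"
    unfolding internal_degree_def by (intro Max_in) (auto simp: finite_full_minors)
  then show ?thesis using less G by (auto simp: full_minors_carrier)
qed

section \<open>Polynomial relations between equivalent encoders\<close>

text \<open>Over Laurent series \<open>G\<^sub>1 = U G\<^sub>2\<close>, as each row of
  \<open>G\<^sub>1\<close> is a codeword. On the columns \<open>J\<close> this reads
  \<open>H\<^sub>1 = U H\<^sub>2\<close>, and multiplying by the adjugate of
  \<open>H\<^sub>2\<close> shows that \<open>det H\<^sub>2\<close> clears the denominators of
  \<open>U\<close>.\<close>

lemma equivalent_encoders_imp_relation:
  fixes G\<^sub>1 G\<^sub>2 :: "'a::comm_ring_1 poly mat"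
  assumes eq: "code G\<^sub>1 = code G\<^sub>2"
    and G\<^sub>1: "G\<^sub>1 \<in> carrier_mat k n" and G\<^sub>2: "G\<^sub>2 \<in> carrier_mat k n"
    and J: "J \<subseteq> {..<n}" "card J = k"
  obtains A where "A \<in> carrier_mat k k" and "det (submatrix G\<^sub>2 UNIV J) \<cdot>\<^sub>m G\<^sub>1 = A * G\<^sub>2"
proof -
  let ?h = "\<lambda>a :: 'a poly. fps_to_fls (fps_of_poly a)"
  let ?F = "map_mat ?h"
  have "\<exists>u \<in> carrier_vec k. row (?F G\<^sub>1) i = (?F G\<^sub>2)\<^sup>T *\<^sub>v u" if i: "i < k" for i
  proof -
    have "row (?F G\<^sub>1) i = (?F G\<^sub>1)\<^sup>T *\<^sub>v unit_vec k i"
      using G\<^sub>1 i by (intro eq_vecI) auto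
    then have "row (?F G\<^sub>1) i \<in> code G\<^sub>1"
      using G\<^sub>1 unfolding code_def by (auto intro!: exI[of _ "unit_vec k i"])
    then show ?thesis using G\<^sub>2 unfolding eq by (auto simp: code_def)
  qed
  then obtain u where u: "\<And>i. i < k \<Longrightarrow> u i \<in> carrier_vec k"
      "\<And>i. i < k \<Longrightarrow> row (?F G\<^sub>1) i = (?F G\<^sub>2)\<^sup>T *\<^sub>v u i"
    by metis
  define U where "U = mat k k (\<lambda>(i, j). u i $ j)"
  have U: "U \<in> carrier_mat k k" by (simp add: U_def)
  have FG: "?F G\<^sub>1 = U * ?F G\<^sub>2"
  proof (rule eq_matI)
    fix i j assume "i < dim_row (U * ?F G\<^sub>2)" "j < dim_col (U * ?F G\<^sub>2)"
    then have ij: "i < k" "j < n" using U G\<^sub>2 by auto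
    have "?F G\<^sub>1 $$ (i, j) = row (?F G\<^sub>1) i $ j" using ij G\<^sub>1 by simp
    also have "\<dots> = ((?F G\<^sub>2)\<^sup>T *\<^sub>v u i) $ j" using u(2) ij by simp
    also have "\<dots> = col (?F G\<^sub>2) j \<bullet> u i" using ij G\<^sub>2 by simp
    also have "\<dots> = u i \<bullet> col (?F G\<^sub>2) j"
      using ij G\<^sub>2 u(1) by (intro comm_scalar_prod[of _ k]) auto
    also have "u i = row U i" using ij u(1)[OF ij(1)] by (intro eq_vecI) (auto simp: U_def)
    finally show "?F G\<^sub>1 $$ (i, j) = (U * ?F G\<^sub>2) $$ (i, j)" using ij U G\<^sub>2 by simp
  qed (use U G\<^sub>1 G\<^sub>2 in auto)
  let ?H\<^sub>1 = "submatrix G\<^sub>1 UNIV J" and ?H\<^sub>2 = "submatrix G\<^sub>2 UNIV J"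
  note H\<^sub>1 = full_submatrix[OF G\<^sub>1 J] and H\<^sub>2 = full_submatrix[OF G\<^sub>2 J]
  have sub: "submatrix (?F G) UNIV J = ?F (submatrix G UNIV J)" if G: "G \<in> carrier_mat k n" for G
  proof -
    have FG: "?F G \<in> carrier_mat k n" using G by simp
    show ?thesis
      using full_submatrix[OF G J] full_submatrix[OF FG J] G by (intro eq_matI) auto
  qed
  have "?F ?H\<^sub>1 = U * ?F ?H\<^sub>2"
    using submatrix_mult_right[OF U _ J, of "?F G\<^sub>2"] FG sub[OF G\<^sub>1] sub[OF G\<^sub>2] G\<^sub>2 by simp
  \<comment> \<open>By Cramer's rule this polynomial matrix is \<open>det H\<^sub>2\<close> times
    \<open>U\<close> over the Laurent series.\<close>
  define A where "A = ?H\<^sub>1 * adj_mat ?H\<^sub>2"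
  note adj = adj_mat[OF H\<^sub>2(1)]
  have A: "A \<in> carrier_mat k k" using H\<^sub>1(1) adj(1) by (simp add: A_def)
  have "?F A = ?F ?H\<^sub>1 * ?F (adj_mat ?H\<^sub>2)"
    unfolding A_def by (rule poly_to_fls.mat_hom_mult[OF H\<^sub>1(1) adj(1)])
  also have "\<dots> = U * (?F ?H\<^sub>2 * ?F (adj_mat ?H\<^sub>2))"
    unfolding \<open>?F ?H\<^sub>1 = U * ?F ?H\<^sub>2\<close>
    by (rule assoc_mult_mat[OF U]) (use H\<^sub>2(1) adj(1) in auto)
  also have "?F ?H\<^sub>2 * ?F (adj_mat ?H\<^sub>2) = ?F (det ?H\<^sub>2 \<cdot>\<^sub>m 1\<^sub>m k)"
    using poly_to_fls.mat_hom_mult[OF H\<^sub>2(1) adj(1)] adj(2) by simp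
  also have "\<dots> = ?h (det ?H\<^sub>2) \<cdot>\<^sub>m 1\<^sub>m k"
    by (intro eq_matI) auto
  also have "U * \<dots> = ?h (det ?H\<^sub>2) \<cdot>\<^sub>m U"
    using mult_smult_distrib[OF U one_carrier_mat, of "?h (det ?H\<^sub>2)"] right_mult_one_mat[OF U] by simp
  finally have FA: "?F A = ?h (det ?H\<^sub>2) \<cdot>\<^sub>m U" .
  have "?F (A * G\<^sub>2) = ?F A * ?F G\<^sub>2"
    by (rule poly_to_fls.mat_hom_mult[OF A G\<^sub>2])
  also have "\<dots> = ?h (det ?H\<^sub>2) \<cdot>\<^sub>m (U * ?F G\<^sub>2)"
    unfolding FA by (rule mult_smult_assoc_mat[OF U]) (use G\<^sub>2 in auto)
  also have "\<dots> = ?F (det ?H\<^sub>2 \<cdot>\<^sub>m G\<^sub>1)"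
    unfolding FG[symmetric] by (intro eq_matI) (auto simp: poly_to_fls.hom_mult)
  finally have "det ?H\<^sub>2 \<cdot>\<^sub>m G\<^sub>1 = A * G\<^sub>2"
    using poly_to_fls.mat_hom_inj by metis
  with A show thesis by (rule that)
qed

text \<open>Each minor of the product is \<open>det S\<close> times the minor of \<open>G\<close> on
  the same columns, and a nonzero product comes from a nonzero minor of \<open>G\<close>.\<close>

lemma Gcd_full_minors_mult_dvd:
  fixes G :: "'a::field_gcd poly mat"
  assumes S: "S \<in> carrier_mat k k" and G: "G \<in> carrier_mat k n"
  shows "Gcd (full_minors G - {0}) dvd Gcd (full_minors (S * G) - {0})"
proof (rule Gcd_greatest)
  fix x assume x: "x \<in> full_minors (S * G) - {0}"
  have SG: "S * G \<in> carrier_mat k n" using S G by simp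
  from x obtain J where J: "J \<subseteq> {..<n}" "card J = k" "x = det (submatrix (S * G) UNIV J)"
    unfolding full_minors_carrier[OF SG] by blast
  then have eq: "x = det S * det (submatrix G UNIV J)" using full_minor_mult[OF S G] by simp
  with x J have "det (submatrix G UNIV J) \<in> full_minors G - {0}"
    by (auto simp: full_minors_carrier[OF G])
  then show "Gcd (full_minors G - {0}) dvd x" unfolding eq by (intro dvd_mult Gcd_dvd)
qed


subsection \<open>Coefficient rings with nilpotent maximal ideal\<close>

text \<open>Models reduction from integers modulo \<open>p ^ r\<close> to the prime field, with
  \<pi> in the role of \<open>p\<close>. The kernel is described twice: as the multiples of \<pi>,
  which yields nilpotency, and as the annihilator of \<open>\<pi> ^ (r - 1)\<close>, which turns
  vanishing modulo \<pi> into an equation in the ring itself.\<close>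

locale residue_reduction = comm_ring_hom hom
  for hom :: "'a::comm_ring_1 \<Rightarrow> 'b::field_gcd" +
  fixes \<pi> :: 'a and r :: nat
  assumes surj_hom: "surj hom"
    and hom_eq_0_iff_dvd: "hom x = 0 \<longleftrightarrow> \<pi> dvd x"
    and hom_eq_0_iff_socle: "hom x = 0 \<longleftrightarrow> \<pi> ^ (r - 1) * x = 0"
    and r_pos: "r > 0"
begin

sublocale poly: map_poly_comm_ring_hom hom ..

abbreviation red :: "'a poly \<Rightarrow> 'b poly" where
  "red \<equiv> map_poly hom"

lemma pi_power_r: "\<pi> ^ r = 0"
proof -
  have "\<pi> ^ (r - 1) * \<pi> = 0" by (metis dvd_refl hom_eq_0_iff_dvd hom_eq_0_iff_socle)
  then show ?thesis using r_pos by (metis power_minus_mult)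
qed

lemma const_pi_power_r: "[:\<pi>:] ^ r = 0"
  by (simp add: poly_const_pow pi_power_r)

section \<open>Units, and polynomials that do not vanish modulo \<pi>\<close>

text \<open>If \<open>y\<close> lifts the inverse of \<open>hom x\<close>, then \<open>x * y\<close>
  differs from 1 by a multiple of \<pi>, which is nilpotent.\<close>

lemma unit_iff: "x dvd 1 \<longleftrightarrow> hom x \<noteq> 0"
proof
  assume "x dvd 1"
  then obtain y where "1 = x * y" by (elim dvdE)
  then have "1 = hom x * hom y" by (metis hom_mult hom_one)
  then show "hom x \<noteq> 0" by auto
next
  assume x: "hom x \<noteq> 0"
  obtain y where y: "hom y = inverse (hom x)" using surj_hom by (metis surjD)
  have "hom (1 - x * y) = 0" using x y by (simp add: hom_minus hom_mult)
  then obtain z where z: "1 - x * y = \<pi> * z" by (metis hom_eq_0_iff_dvd dvdE)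
  have "(\<pi> * z) ^ r = 0" by (simp add: power_mult_distrib pi_power_r)
  then have "1 - \<pi> * z dvd 1" by (rule power_nilpotent_imp_unit)
  moreover have "1 - \<pi> * z = x * y" using z by (simp add: algebra_simps)
  ultimately show "x dvd 1" by (metis dvd_mult_left)
qed

lemma red_eq_0_imp_dvd:
  assumes "red f = 0"
  shows "[:\<pi>:] dvd f"
proof -
  \<comment> \<open>The quotient of 0 must be chosen as 0, so that \<open>map_poly d\<close> acts
    coefficientwise beyond the degree as well.\<close>
  have "\<exists>y. x = \<pi> * y \<and> (x = 0 \<longrightarrow> y = 0)" if "\<pi> dvd x" for x
    using that by (metis dvdE mult_zero_right)
  then obtain d where d: "\<And>x. \<pi> dvd x \<Longrightarrow> x = \<pi> * d x \<and> (x = 0 \<longrightarrow> d x = 0)"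
    by metis
  have "hom (coeff f i) = 0" for i using assms by (simp add: poly_eq_iff)
  then have "\<pi> dvd coeff f i" for i by (simp add: hom_eq_0_iff_dvd)
  then have "f = [:\<pi>:] * map_poly d f"
    using d d[of 0] by (intro poly_eqI) (simp add: coeff_map_poly)
  then show ?thesis by (rule dvdI)
qed

text \<open>
  Dividing the error term by the part with unit leading coefficient and multiplying by the unit
  \<open>1 - \<pi>\<^sup>i q\<close> squares the power of \<open>\<pi>\<close> in front of the error.
\<close>

lemma unit_lead_coeff_refine:
  assumes "i > 0" and "lead_coeff g dvd 1" and "f = g + [:\<pi>:] ^ i * h"
  shows "\<exists>w. w dvd 1 \<and> degree (w * f) = degree g \<and> lead_coeff (w * f) dvd 1"
  using assms
proof (induction "r - i" arbitrary: i f g h rule: less_induct)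
  case less
  show ?case
  proof (cases "i \<ge> r")
    case True
    then have "[:\<pi>:] ^ i = 0" by (metis const_pi_power_r dvd_0_left le_imp_power_dvd)
    with less.prems show ?thesis by (intro exI[of _ 1]) simp
  next
    case False
    let ?c = "[:\<pi>:] ^ i"
    obtain q s where h: "h = g * q + s" and s: "s = 0 \<or> degree s < degree g"
      using unit_lead_coeff_division[OF less.prems(2)] by blast
    \<comment> \<open>The factor \<open>?c\<close> is a constant, so the remainder can be absorbed
      into \<open>g\<close> without touching its degree or leading coefficient.\<close>
    have "degree (?c * s) < degree g \<or> ?c * s = 0"
      using s degree_mult_le[of ?c s] by (auto simp: poly_const_pow)
    then have dg: "degree (g + ?c * s) = degree g"
        and lg: "lead_coeff (g + ?c * s) = lead_coeff g"
      by (auto simp: degree_add_eq_left coeff_eq_0)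
    define w\<^sub>0 where "w\<^sub>0 = 1 - ?c * q"
    have "(?c * q) ^ r = 0"
    proof -
      have "?c ^ r = ([:\<pi>:] ^ r) ^ i" by (simp only: mult.commute flip: power_mult)
      then have "?c ^ r = 0" using less.prems(1) by (simp add: const_pi_power_r zero_power)
      then show ?thesis by (simp add: power_mult_distrib)
    qed
    then have w\<^sub>0: "w\<^sub>0 dvd 1" unfolding w\<^sub>0_def by (rule power_nilpotent_imp_unit)
    have "w\<^sub>0 * f = (g + ?c * s) + [:\<pi>:] ^ (2 * i) * (- (q * h))"
      unfolding w\<^sub>0_def less.prems(3) mult_2 power_add by (simp add: h algebra_simps)
    then obtain w where w: "w dvd 1" "degree (w * (w\<^sub>0 * f)) = degree g" "lead_coeff (w * (w\<^sub>0 * f)) dvd 1"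
      using less.hyps[of "2 * i" "g + ?c * s" "w\<^sub>0 * f" "- (q * h)"] less.prems(1,2) False
      unfolding dg lg by (metis diff_less_mono2 lg dg mult_2 less_add_same_cancel1 not_le_imp_less add_pos_pos)
    show ?thesis
      by (rule exI[of _ "w * w\<^sub>0"])
        (use w w\<^sub>0 mult_dvd_mono[of w 1 w\<^sub>0 1] in \<open>auto simp: mult.assoc\<close>)
  qed
qed

text \<open>A polynomial form of Weierstrass preparation. Cutting \<open>f\<close> off after the
  degree of its reduction leaves a \<open>g\<close> with unit leading coefficient, and the tail is
  divisible by \<pi>; this starts the refinement at exponent 1.\<close>

lemma regular_associated_unit_lead:
  assumes "red f \<noteq> 0"
  obtains w where "w dvd 1" "degree (w * f) = degree (red f)" "lead_coeff (w * f) dvd 1"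
proof -
  let ?d = "degree (red f)"
  define g where "g = poly_cutoff (Suc ?d) f"
  have cg: "coeff g i = (if i \<le> ?d then coeff f i else 0)" for i
    by (simp add: g_def coeff_poly_cutoff less_Suc_eq_le)
  have "coeff (red f) ?d \<noteq> 0" using assms leading_coeff_0_iff by blast
  then have "hom (coeff f ?d) \<noteq> 0" by (simp add: coeff_map_poly)
  then have u: "coeff f ?d dvd 1" by (simp add: unit_iff)
  have dg: "degree g = ?d"
  proof (rule antisym)
    show "degree g \<le> ?d" by (rule degree_le) (simp add: cg)
    have "coeff g ?d \<noteq> 0" using u by (auto simp: cg)
    then show "?d \<le> degree g" by (rule le_degree)
  qed
  have "red (f - g) = 0"
  proof (rule poly_eqI)
    fix i
    have "hom (coeff f i) = 0" if "i > ?d" using coeff_eq_0[OF that] by simp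
    then show "coeff (red (f - g)) i = coeff 0 i" by (simp add: cg)
  qed
  then obtain h where "f - g = [:\<pi>:] * h" using red_eq_0_imp_dvd by (metis dvdE)
  then have f: "f = g + [:\<pi>:] ^ 1 * h" by (metis add.commute diff_add_cancel power_one_right)
  have lg: "lead_coeff g dvd 1" using u by (simp add: dg cg)
  have "\<exists>w. w dvd 1 \<and> degree (w * f) = degree g \<and> lead_coeff (w * f) dvd 1"
    by (rule unit_lead_coeff_refine[OF _ lg f]) simp
  then obtain w where "w dvd 1" "degree (w * f) = degree g" "lead_coeff (w * f) dvd 1"
    by blast
  with dg show thesis using that[of w] by simp
qed

text \<open>All coefficients below the first unit coefficient are multiples of \<pi>. Removing them
  gives \<open>g\<close> with trailing unit such that \<open>g - f\<close> is nilpotent; then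
  \<open>f\<close> divides a power of \<open>g\<close>, which is invertible as a rational
  function.\<close>

lemma regular_imp_ratfun_unit:
  assumes "red f \<noteq> 0"
  shows "ratfun_of_poly f dvd 1"
proof -
  define t where "t = (LEAST i. hom (coeff f i) \<noteq> 0)"
  have ex: "\<exists>i. hom (coeff f i) \<noteq> 0" using assms by (auto simp: poly_eq_iff)
  have t: "hom (coeff f t) \<noteq> 0" "\<forall>i<t. hom (coeff f i) = 0"
    using LeastI_ex[OF ex] not_less_Least unfolding t_def by blast+
  define g where "g = f - poly_cutoff t f"
  have cg: "coeff g i = (if i < t then 0 else coeff f i)" for i
    by (simp add: g_def coeff_poly_cutoff)
  have "trailing_unit g"
    unfolding trailing_unit_def by (rule exI[of _ t]) (use t in \<open>simp add: cg unit_iff\<close>)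
  then have tr: "trailing_unit (g ^ m)" for m
    by (induction m) (auto intro: trailing_unit_mult trailing_unit_1)
  have "red (g - f) = 0" by (rule poly_eqI) (use t in \<open>auto simp: cg hom_uminus\<close>)
  then obtain h where "g - f = [:\<pi>:] * h" using red_eq_0_imp_dvd by (metis dvdE)
  then have "(g - f) ^ r = 0" by (simp only: power_mult_distrib const_pi_power_r mult_zero_left)
  \<comment> \<open>A difference of \<open>r\<close>-th powers is divisible by the difference of the
    bases, here \<open>g - (g - f) = f\<close>.\<close>
  moreover have "f dvd g ^ r - (g - f) ^ r"
    using power_diff_sumr2[of g r "g - f"] by simp
  ultimately have "f dvd g ^ r" by simp
  then have "ratfun_of_poly f dvd ratfun_of_poly (g ^ r)"
    by (auto elim!: dvdE simp: ratfun_of_poly.hom_mult)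
  then show ?thesis using trailing_unit_imp_ratfun_unit[OF tr] dvd_trans by blast
qed

section \<open>Minors of encoders that do not vanish modulo \<pi>\<close>

lemma red_eq_0_iff_socle: "red f = 0 \<longleftrightarrow> [:\<pi> ^ (r - 1):] * f = 0"
  by (simp add: poly_eq_iff hom_eq_0_iff_socle)

text \<open>The reduced rows stay independent: lift a relation between them and multiply it by
  \<open>\<pi> ^ (r - 1)\<close>. The result is a relation between the rows of \<open>G\<close>,
  hence trivial, and so the original relation is zero modulo \<pi>.\<close>

lemma generator_matrix_regular_minor:
  assumes "generator_matrix k n G"
  obtains J where "J \<subseteq> {..<n}" "card J = k" "red (det (submatrix G UNIV J)) \<noteq> 0"
proof -
  from assms have G: "G \<in> carrier_mat k n"
    and indep: "\<And>u. u \<in> carrier_vec k \<Longrightarrow> (ratfun_mat G)\<^sup>T *\<^sub>v u = 0\<^sub>v n \<Longrightarrow> u = 0\<^sub>v k"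
    by (auto simp: generator_matrix_def)
  have "\<exists>J. J \<subseteq> {..<n} \<and> card J = k \<and> det (submatrix (map_mat red G) UNIV J) \<noteq> 0"
  proof (rule independent_rows_imp_full_minor_nonzero)
    show "map_mat red G \<in> carrier_mat k n" using G by simp
    fix u assume u: "u \<in> carrier_vec k" "(map_mat red G)\<^sup>T *\<^sub>v u = 0\<^sub>v n"
    have "\<exists>q. red q = u $ i" for i by (rule poly_lift_exists) (simp_all add: surj_hom)
    then obtain U where U: "\<And>i. red (U i) = u $ i" by metis
    let ?s = "[:\<pi> ^ (r - 1):]"
    define V where "V = vec k (\<lambda>i. ratfun_of_poly (?s * U i))"
    have "(ratfun_mat G)\<^sup>T *\<^sub>v V = 0\<^sub>v n"
    proof (rule eq_vecI)
      fix j assume "j < dim_vec (0\<^sub>v n :: 'a ratfun vec)"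
      then have j: "j < n" by simp
      have "red (\<Sum>i<k. G $$ (i, j) * U i) = (\<Sum>i<k. red (G $$ (i, j)) * u $ i)"
        by (simp add: poly.hom_sum poly.hom_mult U)
      also have "\<dots> = ((map_mat red G)\<^sup>T *\<^sub>v u) $ j"
        using j G u(1) by (simp add: scalar_prod_def lessThan_atLeast0)
      also have "\<dots> = 0" using u(2) j by simp
      finally have 0: "?s * (\<Sum>i<k. G $$ (i, j) * U i) = 0" by (simp only: red_eq_0_iff_socle)
      have "((ratfun_mat G)\<^sup>T *\<^sub>v V) $ j = (\<Sum>i<k. ratfun_of_poly (G $$ (i, j)) * ratfun_of_poly (?s * U i))"
        using j G by (simp add: V_def scalar_prod_def lessThan_atLeast0)
      also have "\<dots> = (\<Sum>i<k. ratfun_of_poly (?s * (G $$ (i, j) * U i)))"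
        by (simp only: ratfun_of_poly.hom_mult mult.left_commute)
      also have "\<dots> = ratfun_of_poly (?s * (\<Sum>i<k. G $$ (i, j) * U i))"
        by (simp only: sum_distrib_left ratfun_of_poly.hom_sum)
      finally show "((ratfun_mat G)\<^sup>T *\<^sub>v V) $ j = 0\<^sub>v n $ j"
        unfolding 0 using j by simp
    qed (use G in simp)
    then have V0: "V = 0\<^sub>v k" by (intro indep) (auto simp: V_def)
    show "u = 0\<^sub>v k"
    proof (rule eq_vecI)
      fix i assume "i < dim_vec (0\<^sub>v k :: 'b poly vec)"
      then have i: "i < k" by simp
      then have "V $ i = 0" using V0 by simp
      then have "ratfun_of_poly (?s * U i) = 0" using i by (simp only: V_def index_vec)
      then have "?s * U i = 0" by (rule ratfun_of_poly.hom_0)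
      then have "red (U i) = 0" by (simp only: red_eq_0_iff_socle)
      then show "u $ i = 0\<^sub>v k $ i" using U i by simp
    qed (use u(1) in simp)
  qed
  then show thesis using that poly.full_minor_hom[OF G] by metis
qed

section \<open>Consequences of minimal internal degree\<close>

text \<open>Since \<open>b\<close> and \<open>det A\<close> are invertible as rational functions,
  \<open>A\<close> divided by \<open>b\<close> is an invertible matrix \<open>M\<close> with
  \<open>G' = M G\<close>, so \<open>G'\<close> is an admissible competitor.\<close>

lemma is_RIDM_minimal:
  assumes ridm: "is_RIDM k n G" and G': "G' \<in> carrier_mat k n" and A: "A \<in> carrier_mat k k"
    and eq: "b \<cdot>\<^sub>m G' = A * G" and b: "red b \<noteq> 0" and det: "red (det A) \<noteq> 0"
  shows "internal_degree G \<le> internal_degree G'"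
proof -
  let ?h = ratfun_of_poly
  have G: "G \<in> carrier_mat k n" using ridm by (simp add: is_RIDM_def generator_matrix_def)
  from regular_imp_ratfun_unit[OF b] obtain c where c: "c * ?h b = 1"
    by (metis dvdE mult.commute)
  define M where "M = c \<cdot>\<^sub>m ratfun_mat A"
  have M: "M \<in> carrier_mat k k" using A by (simp add: M_def)
  have "c dvd 1" using c by (metis dvd_triv_left)
  then have "c ^ k * ?h (det A) dvd 1 * 1"
    using regular_imp_ratfun_unit[OF det] dvd_power_same[of c 1 k] by (intro mult_dvd_mono) auto
  then have "det M dvd 1" using A by (simp add: M_def)
  then have inv: "invertible_mat M" by (rule dvd_one_imp_invertible_mat[OF M])
  have "?h b \<cdot>\<^sub>m ratfun_mat G' = ratfun_mat (b \<cdot>\<^sub>m G')"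
    by (intro eq_matI) (auto simp: ratfun_of_poly.hom_mult)
  also have "\<dots> = ratfun_mat A * ratfun_mat G"
    unfolding eq by (rule ratfun_of_poly.mat_hom_mult[OF A G])
  finally have "c \<cdot>\<^sub>m (?h b \<cdot>\<^sub>m ratfun_mat G') = c \<cdot>\<^sub>m (ratfun_mat A * ratfun_mat G)"
    by simp
  moreover have "c \<cdot>\<^sub>m (?h b \<cdot>\<^sub>m ratfun_mat G') = ratfun_mat G'"
    using c by (intro eq_matI) (auto simp flip: mult.assoc)
  moreover have "c \<cdot>\<^sub>m (ratfun_mat A * ratfun_mat G) = M * ratfun_mat G"
    unfolding M_def by (rule mult_smult_assoc_mat[symmetric, of _ k k _ n]) (use A G in auto)
  ultimately have "ratfun_mat G' = M * ratfun_mat G" by simp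
  then show ?thesis using ridm M G' inv unfolding is_RIDM_def by blast
qed

text \<open>
  Up to a unit of the polynomial ring, which scales one row of \<open>G'\<close>, both \<open>det A\<close> and \<open>b\<^sup>k\<close> have
  a unit leading coefficient, so that they shift the degrees of all minors by exactly the degrees of
  their reductions.
\<close>

lemma is_RIDM_degree_le:
  assumes ridm: "is_RIDM k n G" and G': "G' \<in> carrier_mat k n" and A: "A \<in> carrier_mat k k"
    and eq: "b \<cdot>\<^sub>m G' = A * G" and b: "red b \<noteq> 0" and det: "red (det A) \<noteq> 0"
  shows "k * degree (red b) \<le> degree (red (det A))"
proof (cases "k = 0")
  \<comment> \<open>A row to scale exists only for \<open>k > 0\<close>; for \<open>k = 0\<close>
    the left-hand side is zero.\<close>
  case False
  then have k: "0 < k" by simp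
  show ?thesis
  proof (rule ccontr)
    assume "\<not> ?thesis"
    then have less: "degree (red (det A)) < k * degree (red b)" by simp
    have gen: "generator_matrix k n G" using ridm by (simp add: is_RIDM_def)
    then have G: "G \<in> carrier_mat k n" by (simp add: generator_matrix_def)
    let ?m = "\<lambda>G. \<lambda>J. det (submatrix G UNIV J)"
    obtain w where w: "w dvd 1" "degree (w * det A) = degree (red (det A))" "lead_coeff (w * det A) dvd 1"
      using regular_associated_unit_lead[OF det] .
    have rb: "red (b ^ k) = red b ^ k" by (rule poly.hom_power)
    then have "red (b ^ k) \<noteq> 0" using b by simp
    then obtain v where v: "v dvd 1" "degree (v * b ^ k) = degree (red (b ^ k))" "lead_coeff (v * b ^ k) dvd 1"
      using regular_associated_unit_lead by blast
    then obtain v' where v': "v * v' = 1" by (metis dvdE)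
    \<comment> \<open>Scaling row 0 of \<open>G'\<close> by \<open>u\<close> multiplies its minors
      by \<open>w\<close> and by the inverse of \<open>v\<close>, so that \<open>v * b ^ k\<close>
      and \<open>w * det A\<close> become the factors relating the minors.\<close>
    define u where "u = w * v'"
    have "v' dvd 1" using v' by (metis dvd_triv_right)
    then have "u dvd 1 * 1" unfolding u_def using w(1) by (intro mult_dvd_mono)
    then obtain u' where "u * u' = 1" by (metis dvdE mult_1)
    then have "red u * red u' = 1" by (metis poly.hom_mult poly.hom_one)
    then have u: "red u \<noteq> 0" by auto
    define E where "E = multrow_mat k 0 u"
    have E: "E \<in> carrier_mat k k" by (simp add: E_def)
    have detE: "det E = u" unfolding E_def by (rule det_multrow_mat[OF k])
    have EG': "E * G' \<in> carrier_mat k n" using E G' by simp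
    have "b \<cdot>\<^sub>m (E * G') = E * (b \<cdot>\<^sub>m G')"
      by (rule mult_smult_distrib[OF E G', symmetric])
    also have "\<dots> = E * A * G" unfolding eq by (rule assoc_mult_mat[OF E A G, symmetric])
    finally have eq': "b \<cdot>\<^sub>m (E * G') = E * A * G" .
    have "red (det (E * A)) \<noteq> 0"
      using u det by (simp add: det_mult[OF E A] detE poly.hom_mult)
    with eq' have le: "internal_degree G \<le> internal_degree (E * G')"
      by (intro is_RIDM_minimal[OF ridm EG' _ _ b, where A = "E * A"]) (use E A in simp_all)
    have minor: "(v * b ^ k) * ?m (E * G') J = (w * det A) * ?m G J"
      if J: "J \<subseteq> {..<n}" "card J = k" for J
    proof -
      have "b ^ k * ?m G' J = det A * ?m G J"
        using full_minor_smult[OF G' J, of b] full_minor_mult[OF A G J] eq by simp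
      moreover have "?m (E * G') J = w * v' * ?m G' J"
        using full_minor_mult[OF E G' J] by (simp add: detE u_def)
      then have "(v * b ^ k) * ?m (E * G') J = (v * v') * w * (b ^ k * ?m G' J)"
        by (simp only: mult_ac)
      ultimately show ?thesis by (simp only: v' mult_1 mult.assoc)
    qed
    have deg: "degree (?m (E * G') J) < degree (?m G J)"
      if J: "J \<subseteq> {..<n}" "card J = k" and 0: "?m G J \<noteq> 0" for J
    proof -
      note 1 = unit_lead_coeff_mult[OF w(3) 0]
      then have "?m (E * G') J \<noteq> 0" using minor[OF J] by auto
      note 2 = unit_lead_coeff_mult(1)[OF v(3) this]
      have "degree (red (b ^ k)) = k * degree (red b)"
        unfolding rb using b by (simp add: degree_power_eq)
      then show ?thesis using 1(1) 2 minor[OF J] less w(2) v(2) by simp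
    qed
    obtain J\<^sub>0 where J\<^sub>0: "J\<^sub>0 \<subseteq> {..<n}" "card J\<^sub>0 = k" "red (?m G J\<^sub>0) \<noteq> 0"
      using generator_matrix_regular_minor[OF gen] .
    \<comment> \<open>Zero minors count with degree 0, so a strict bound for them requires a
      positive internal degree of \<open>G\<close>.\<close>
    then have pos: "0 < internal_degree G"
      using deg[of J\<^sub>0] internal_degree_ge[OF G J\<^sub>0(1,2)] by fastforce
    have "internal_degree (E * G') < internal_degree G"
    proof (rule internal_degree_less[OF EG' J\<^sub>0(1,2)])
      fix J assume J: "J \<subseteq> {..<n}" "card J = k"
      show "degree (?m (E * G') J) < internal_degree G"
      proof (cases "?m G J = 0")
        case True
        then have "(v * b ^ k) * ?m (E * G') J = 0" using minor[OF J] by simp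
        then have "?m (E * G') J = 0" using unit_lead_coeff_mult(2)[OF v(3)] by blast
        then show ?thesis using pos by simp
      next
        case False
        then show ?thesis using deg[OF J False] internal_degree_ge[OF G J] by simp
      qed
    qed
    with le show False by simp
  qed
qed simp

text \<open>
  Otherwise the row \<open>j\<close> of \<open>G\<^sub>2\<close> can be exchanged for a row whose coefficient at that place is the
  remainder of \<open>A\<^sub>i\<^sub>j\<close> modulo \<open>b\<close>; this lowers the degree of the reduced determinant.
\<close>

lemma is_RIDM_red_dvd:
  assumes ridm: "is_RIDM k n G\<^sub>2" and G\<^sub>1: "G\<^sub>1 \<in> carrier_mat k n" and A: "A \<in> carrier_mat k k"
    and eq: "b \<cdot>\<^sub>m G\<^sub>1 = A * G\<^sub>2" and b: "red b \<noteq> 0" and ij: "i < k" "j < k"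
  shows "red b dvd red (A $$ (i, j))"
proof (rule ccontr)
  assume ndvd: "\<not> red b dvd red (A $$ (i, j))"
  have G\<^sub>2: "G\<^sub>2 \<in> carrier_mat k n" using ridm by (simp add: is_RIDM_def generator_matrix_def)
  \<comment> \<open>Division with remainder takes place over the residue field; the quotient is
    lifted, and \<open>c\<close> then reduces to the remainder.\<close>
  obtain q where q: "red q = red (A $$ (i, j)) div red b"
    using poly_lift_exists[OF surj_hom hom_zero] by blast
  define c where "c = A $$ (i, j) - b * q"
  have red_c: "red c = red (A $$ (i, j)) mod red b"
    by (simp add: c_def poly.hom_minus poly.hom_mult q minus_mult_div_eq_mod)
  have c0: "red c \<noteq> 0" using ndvd by (simp add: red_c mod_eq_0_iff_dvd)
  have dc: "degree (red c) < degree (red b)"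
    unfolding red_c by (rule degree_mod_less_degree[OF b ndvd])
  \<comment> \<open>Row \<open>j\<close> becomes row \<open>i\<close> of \<open>G\<^sub>1\<close>
    minus \<open>q\<close> times row \<open>j\<close> of \<open>G\<^sub>2\<close>. Accordingly
    \<open>A'\<close> is \<open>b\<close> times the identity with row \<open>j\<close> replaced by
    row \<open>i\<close> of \<open>A\<close>, corrected to \<open>c\<close> on the diagonal.\<close>
  define G' where "G' = mat k n (\<lambda>(l, m). if l = j then G\<^sub>1 $$ (i, m) - q * G\<^sub>2 $$ (j, m) else G\<^sub>2 $$ (l, m))"
  define A' where "A' = mat k k (\<lambda>(l, m). if l = j then if m = j then c else A $$ (i, m)
      else if l = m then b else 0)"
  have G': "G' \<in> carrier_mat k n" and A': "A' \<in> carrier_mat k k" by (simp_all add: G'_def A'_def)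
  have "b \<cdot>\<^sub>m G' = A' * G\<^sub>2"
  proof (rule eq_matI)
    fix l m assume "l < dim_row (A' * G\<^sub>2)" "m < dim_col (A' * G\<^sub>2)"
    then have lm: "l < k" "m < n" using A' G\<^sub>2 by auto
    have prod: "(A' * G\<^sub>2) $$ (l, m) = (\<Sum>s<k. A' $$ (l, s) * G\<^sub>2 $$ (s, m))"
      using lm A' G\<^sub>2 by (simp add: scalar_prod_def lessThan_atLeast0)
    show "(b \<cdot>\<^sub>m G') $$ (l, m) = (A' * G\<^sub>2) $$ (l, m)"
    proof (cases "l = j")
      case True
      have "(\<Sum>s<k. A' $$ (l, s) * G\<^sub>2 $$ (s, m))
          = (\<Sum>s<k. A $$ (i, s) * G\<^sub>2 $$ (s, m) - (if s = j then b * q * G\<^sub>2 $$ (s, m) else 0))"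
        using ij True by (intro sum.cong) (auto simp: A'_def c_def algebra_simps)
      also have "\<dots> = (A * G\<^sub>2) $$ (i, m) - b * q * G\<^sub>2 $$ (j, m)"
        using ij lm A G\<^sub>2 by (simp add: sum_subtractf scalar_prod_def lessThan_atLeast0)
      also have "\<dots> = b * G' $$ (l, m)"
        using ij lm True G\<^sub>1 unfolding eq[symmetric] by (simp add: G'_def algebra_simps)
      finally show ?thesis using prod lm G' by simp
    next
      case False
      have "(\<Sum>s<k. A' $$ (l, s) * G\<^sub>2 $$ (s, m)) = (\<Sum>s<k. if s = l then b * G\<^sub>2 $$ (s, m) else 0)"
        using lm False by (intro sum.cong) (auto simp: A'_def)
      also have "\<dots> = b * G' $$ (l, m)" using lm False by (simp add: G'_def)
      finally show ?thesis using prod lm G' by simp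
    qed
  qed (use A' G' G\<^sub>2 in auto)
  moreover have "det A' = c * b ^ (k - 1)"
  proof -
    \<comment> \<open>The only nonzero entry of column \<open>j\<close> is the diagonal one,
      \<open>c\<close>.\<close>
    have "det A' = (\<Sum>l<k. A' $$ (l, j) * cofactor A' l j)"
      by (rule laplace_expansion_column[OF A' ij(2)])
    also have "\<dots> = (\<Sum>l<k. if l = j then c * cofactor A' j j else 0)"
      using ij by (intro sum.cong) (auto simp: A'_def)
    also have "\<dots> = c * cofactor A' j j" using ij by simp
    also have "mat_delete A' j j = b \<cdot>\<^sub>m 1\<^sub>m (k - 1)"
      using ij by (intro eq_matI) (auto simp: mat_delete_def A'_def)
    then have "cofactor A' j j = b ^ (k - 1)" by (simp add: cofactor_def)
    finally show ?thesis .
  qed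
  then have det: "red (det A') = red c * red b ^ (k - 1)"
    by (simp add: poly.hom_mult poly.hom_power)
  ultimately have "k * degree (red b) \<le> degree (red (det A'))"
    using is_RIDM_degree_le[OF ridm G' A' _ b] b c0 by simp
  also have "\<dots> = degree (red c) + (k - 1) * degree (red b)"
    unfolding det using b c0 by (simp add: degree_mult_eq degree_power_eq)
  also have "\<dots> < degree (red b) + (k - 1) * degree (red b)" using dc by simp
  also have "\<dots> = k * degree (red b)" using ij by (cases k) auto
  finally show False by simp
qed

text \<open>With \<open>b\<close> a minor of \<open>G\<^sub>2\<close> that survives reduction, all
  entries of \<open>A\<close> are divisible by \<open>b\<close> after reduction. Cancelling
  \<open>red b\<close> over the residue field exhibits the reduced \<open>G\<^sub>1\<close> as a
  polynomial multiple of the reduced \<open>G\<^sub>2\<close>.\<close>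

lemma Gcd_red_minors_dvd:
  assumes code: "code G\<^sub>1 = code G\<^sub>2" and G\<^sub>1: "G\<^sub>1 \<in> carrier_mat k n" and ridm: "is_RIDM k n G\<^sub>2"
  shows "Gcd (full_minors (map_mat red G\<^sub>2) - {0}) dvd Gcd (full_minors (map_mat red G\<^sub>1) - {0})"
proof -
  have gen: "generator_matrix k n G\<^sub>2" using ridm by (simp add: is_RIDM_def)
  then have G\<^sub>2: "G\<^sub>2 \<in> carrier_mat k n" by (simp add: generator_matrix_def)
  obtain J where J: "J \<subseteq> {..<n}" "card J = k" and b: "red (det (submatrix G\<^sub>2 UNIV J)) \<noteq> 0"
    using generator_matrix_regular_minor[OF gen] .
  define b where "b = det (submatrix G\<^sub>2 UNIV J)"
  obtain A where A: "A \<in> carrier_mat k k" and eq: "b \<cdot>\<^sub>m G\<^sub>1 = A * G\<^sub>2"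
    using equivalent_encoders_imp_relation[OF code G\<^sub>1 G\<^sub>2 J] unfolding b_def .
  have b0: "red b \<noteq> 0" using b by (simp add: b_def)
  define S where "S = mat k k (\<lambda>(i, j). red (A $$ (i, j)) div red b)"
  have S: "S \<in> carrier_mat k k" by (simp add: S_def)
  have RG: "map_mat red G\<^sub>1 \<in> carrier_mat k n" "map_mat red G\<^sub>2 \<in> carrier_mat k n"
    using G\<^sub>1 G\<^sub>2 by auto
  have RA: "map_mat red A = red b \<cdot>\<^sub>m S"
    using A is_RIDM_red_dvd[OF ridm G\<^sub>1 A eq b0] by (intro eq_matI) (auto simp: S_def)
  have "red b \<cdot>\<^sub>m map_mat red G\<^sub>1 = map_mat red (b \<cdot>\<^sub>m G\<^sub>1)"
    by (intro eq_matI) (auto simp: poly.hom_mult)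
  also have "\<dots> = map_mat red A * map_mat red G\<^sub>2"
    unfolding eq by (rule poly.mat_hom_mult[OF A G\<^sub>2])
  also have "\<dots> = red b \<cdot>\<^sub>m (S * map_mat red G\<^sub>2)"
    unfolding RA by (rule mult_smult_assoc_mat[OF S RG(2)])
  finally have eq': "red b \<cdot>\<^sub>m map_mat red G\<^sub>1 = red b \<cdot>\<^sub>m (S * map_mat red G\<^sub>2)" .
  have "map_mat red G\<^sub>1 = S * map_mat red G\<^sub>2"
  proof (rule eq_matI)
    fix i j assume "i < dim_row (S * map_mat red G\<^sub>2)" "j < dim_col (S * map_mat red G\<^sub>2)"
    then have ij: "i < k" "j < n" using S G\<^sub>2 by auto
    have "(red b \<cdot>\<^sub>m map_mat red G\<^sub>1) $$ (i, j) = red b * map_mat red G\<^sub>1 $$ (i, j)"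
      using ij RG by (intro index_smult_mat) auto
    moreover have "(red b \<cdot>\<^sub>m (S * map_mat red G\<^sub>2)) $$ (i, j) = red b * (S * map_mat red G\<^sub>2) $$ (i, j)"
      using ij S G\<^sub>2 by (intro index_smult_mat) auto
    ultimately show "map_mat red G\<^sub>1 $$ (i, j) = (S * map_mat red G\<^sub>2) $$ (i, j)"
      using eq' b0 by (metis mult_cancel_left)
  qed (use S G\<^sub>1 G\<^sub>2 in auto)
  then show ?thesis using Gcd_full_minors_mult_dvd[OF S RG(2)] by simp
qed

end


subsection \<open>Reduction of integers modulo \<open>p\<^sup>r\<close>\<close>

lemma of_int_mod_ring_eq_0_iff: "(of_int z :: 'a::nontriv mod_ring) = 0 \<longleftrightarrow> int CARD('a) dvd z"
  by (transfer fixing: z) (simp add: dvd_eq_mod_eq_0)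

text \<open>Any other integer representative differs from the chosen one by a multiple of
  \<open>CARD('q)\<close>, hence of \<open>CARD('p)\<close>.\<close>

lemma mod_reduce_of_int:
  assumes "CARD('p::prime_card) dvd CARD('q::nontriv)"
  shows "mod_reduce (of_int z :: 'q mod_ring) = (of_int z :: 'p mod_ring)"
proof -
  let ?t = "to_int_mod_ring (of_int z :: 'q mod_ring)"
  have "(of_int ?t :: 'q mod_ring) = of_int z"
    by (simp only: of_int_of_int_mod_ring of_int_mod_ring_to_int_mod_ring)
  then have "(of_int (?t - z) :: 'q mod_ring) = 0" by (simp only: of_int_diff diff_self)
  then have "int CARD('q) dvd ?t - z" by (simp only: of_int_mod_ring_eq_0_iff)
  then have "int CARD('p) dvd ?t - z" using assms by (meson dvd_trans int_dvd_int_iff)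
  then have "(of_int (?t - z) :: 'p mod_ring) = 0" by (simp only: of_int_mod_ring_eq_0_iff)
  then have "(of_int ?t :: 'p mod_ring) = of_int z" by (simp only: of_int_diff right_minus_eq)
  then show ?thesis by (simp only: mod_reduce_def of_int_of_int_mod_ring)
qed

lemma mod_ring_int_cases:
  fixes x :: "'q::nontriv mod_ring"
  obtains z where "x = of_int z"
  by (metis of_int_mod_ring_to_int_mod_ring of_int_of_int_mod_ring)

lemma residue_reduction_mod_reduce:
  assumes p: "prime p" and r: "r \<ge> 1"
    and q: "CARD('q::nontriv) = p ^ r" and cp: "CARD('p::prime_card) = p"
  shows "residue_reduction (mod_reduce :: 'q mod_ring \<Rightarrow> 'p mod_ring) (of_nat p) r"
proof -
  have "CARD('p) dvd CARD('q)" using r by (simp add: q cp dvd_power)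
  note red = mod_reduce_of_int[OF this]
  have red0: "mod_reduce (of_int z :: 'q mod_ring) = (0 :: 'p mod_ring) \<longleftrightarrow> int p dvd z" for z
    by (simp add: red of_int_mod_ring_eq_0_iff cp)
  show ?thesis
  proof
    fix x y :: "'q mod_ring"
    obtain a b where xy: "x = of_int a" "y = of_int b" by (metis mod_ring_int_cases)
    show "mod_reduce (0 :: 'q mod_ring) = (0 :: 'p mod_ring)"
        "mod_reduce (1 :: 'q mod_ring) = (1 :: 'p mod_ring)"
      using red[of 0] red[of 1] by simp_all
    show "mod_reduce (x + y) = (mod_reduce x + mod_reduce y :: 'p mod_ring)"
      unfolding xy red of_int_add[symmetric] by (rule refl)
    show "mod_reduce (x * y) = (mod_reduce x * mod_reduce y :: 'p mod_ring)"
      unfolding xy red of_int_mult[symmetric] by (rule refl)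
    show "mod_reduce x = (0 :: 'p mod_ring) \<longleftrightarrow> of_nat p dvd x"
    proof
      assume "mod_reduce x = (0 :: 'p mod_ring)"
      then obtain c where "a = int p * c" unfolding xy red0 by (rule dvdE)
      then show "of_nat p dvd x" by (simp add: xy)
    next
      assume "of_nat p dvd x"
      then obtain y where y: "x = of_nat p * y" by (rule dvdE)
      obtain c where "y = of_int c" by (rule mod_ring_int_cases)
      with y have "x = of_int (int p * c)" by simp
      then show "mod_reduce x = (0 :: 'p mod_ring)" by (simp only: red0) simp
    qed
    \<comment> \<open>The annihilator description of the kernel: \<open>p ^ r\<close> divides
      \<open>p ^ (r - 1) * a\<close> exactly when \<open>p\<close> divides \<open>a\<close>.\<close>
    have "of_nat p ^ (r - 1) * x = of_int (int p ^ (r - 1) * a)" by (simp add: xy)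
    also have "\<dots> = 0 \<longleftrightarrow> int p ^ (r - 1) * int p dvd int p ^ (r - 1) * a"
      using r by (simp only: of_int_mod_ring_eq_0_iff q of_nat_power power_minus_mult)
    also have "\<dots> \<longleftrightarrow> int p dvd a" using p by (simp add: prime_gt_0_nat)
    finally show "mod_reduce x = (0 :: 'p mod_ring) \<longleftrightarrow> of_nat p ^ (r - 1) * x = 0"
      by (simp only: xy red0)
  next
    show "surj (mod_reduce :: 'q mod_ring \<Rightarrow> 'p mod_ring)"
      by (rule surjI[where f = "\<lambda>y. of_int (to_int_mod_ring y)"])
        (simp only: red, simp only: of_int_of_int_mod_ring of_int_mod_ring_to_int_mod_ring)
    show "0 < r" using r by simp
  qed
qed

theorem theorem5p2:
  fixes p r k n :: nat
    and G\<^sub>1 G\<^sub>2 :: "'q::nontriv mod_ring poly mat"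
  assumes "prime p" and "r \<ge> 1"
    and "CARD('q) = p ^ r" and "CARD('p::prime_card) = p"
    and "equivalent_encoders k n G\<^sub>1 G\<^sub>2"
    and "is_RIDM k n G\<^sub>1" and "is_RIDM k n G\<^sub>2"
  shows "Delta TYPE('p) G\<^sub>1 = Delta TYPE('p) G\<^sub>2"
proof -
  interpret residue_reduction "mod_reduce :: 'q mod_ring \<Rightarrow> 'p mod_ring" "of_nat p" r
    by (rule residue_reduction_mod_reduce) (use assms in simp_all)
  have code: "code G\<^sub>1 = code G\<^sub>2" and carr: "G\<^sub>1 \<in> carrier_mat k n" "G\<^sub>2 \<in> carrier_mat k n"
    using assms(5) by (simp_all add: equivalent_encoders_def generator_matrix_def)
  show ?thesis
    unfolding Delta_def
    \<comment> \<open>The two gcds divide each other by symmetry, and being normalized they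
      coincide.\<close>
    by (rule associated_eqI)
      (simp_all add: Gcd_red_minors_dvd[OF code carr(1) assms(7)]
        Gcd_red_minors_dvd[OF code[symmetric] carr(2) assms(6)])
qed

end
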